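(* For every $\alpha\le 1$, $d_\alpha$ is a metric on $\mathcal{A}(\mathbb{R}^m)$.
   Context: **Atomic measures.** A (finite) atomic measure on $\mathbb{R}^m$ is $\mathbf{a}=\sum_{i=1}^k m_i\delta_{x_i}$ with distinct $x_i\in\mathbb{R}^m$ and $m_i>0$; its mass is $\|\mathbf{a}\|=\sum_i m_i$. $\mathcal{A}(\mathbb{R}^m)$ is the set of atomic probability measures. **Transport paths.** For atomic measures $\mathbf{a}=\sum_{i=1}^k m_i\delta_{x_i}$, $\mathbf{b}=\sum_{j=1}^\ell n_j\delta_{y_j}$ of equal mass, a transport path from $\mathbf{a}$ to $\mathbf{b}$ is a finite weighted directed graph $G$ with vertex set $V(G)\subset\mathbb{R}^m$ containing all $x_i,y_j$, directed edge set $E(G)$ (straight segments) and weights $w:E(G)\to(0,\infty)$ such that at each vertex $v$ $$\sum_{e^-=v}w(e)=\sum_{e^+=v}w(e)+(m_i\text{ if }v=x_i)+(-n_j\text{ if }v=y_j),$$ where $e^-,e^+$ are the start and end points of $e$ (both extra terms occur if $v=x_i=y_j$). Let $Path(\mathbf{a},\mathbf{b})$ be the set of these. When $\alpha<0$ the following convention is adopted: whenever a directed chain of edges of positive length starts and ends at the same point $v$, its end vertex is viewed as a different copy of $v$, and the balance equation must hold separately at each copy. Precisely, for $\alpha<0$: $V(G)$ is a finite abstract set with a position map to $\mathbb{R}^m$, edges join vertices with distinct positions, $G$ has no directed cycles, each $x_i$ is assigned a single vertex $s_i$ at position $x_i$ and each $y_j$ a single vertex $t_j$ at position $y_j$ ($s_i=t_j$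 is allowed if $x_i=y_j$), and the balance equation holds at each vertex with extra term $+m_i$ at $s_i$ and $-n_j$ at $t_j$. In particular $w(e)\le\|\mathbf{a}\|$ for every edge. For $\alpha\le1$, $\mathbf{M}_\alpha(G)=\sum_{e\in E(G)}w(e)^\alpha\,\mathrm{length}(e)$, and for $\mathbf{a},\mathbf{b}\in\mathcal{A}(\mathbb{R}^m)$, $d_\alpha(\mathbf{a},\mathbf{b})=\inf\{\mathbf{M}_\alpha(G):G\in Path(\mathbf{a},\mathbf{b})\}$. *)

theory Defs
  imports "HOL-Analysis.Analysis" "Graph_Theory.Pair_Digraph"
begin

section \<open>Atomic measures\<close>

definition atomic_measure :: "(real^'m) measure \<Rightarrow> bool" where
  "atomic_measure a \<longleftrightarrow> sets a = sets borel \<and>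
     (\<exists>X m. finite X \<and> (\<forall>x\<in>X. 0 < m x) \<and>
        (\<forall>A\<in>sets borel. emeasure a A = (\<Sum>x\<in>X. ennreal (m x) * indicator A x)))"

definition mass :: "(real^'m) measure \<Rightarrow> real" where
  "mass a = measure a UNIV"

definition atomic_probability_measures :: "(real^'m) measure set" where
  "atomic_probability_measures = {a. atomic_measure a \<and> mass a = 1}"

text \<open>
  The points and coefficients in \<open>a = (\<Sum>i. m\<^sub>i \<delta>\<^bsub>x\<^sub>i\<^esub>)\<close> are determined by
  \<open>a\<close>: the points are the elements of \<open>atoms a\<close>, and the coefficient of \<open>x\<close> is
  \<open>measure a {x}\<close> (lemma \<open>atoms_eqI\<close> below).
\<close>

definition atoms :: "(real^'m) measure \<Rightarrow> (real^'m) set" where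
  "atoms a = {x. 0 < measure a {x}}"

lemma atoms_eqI:
  assumes "finite X" and pos: "\<forall>x\<in>X. 0 < m x"
    and repr: "\<forall>A\<in>sets borel. emeasure a A = (\<Sum>x\<in>X. ennreal (m x) * indicator A x)"
  shows "atoms a = X" and "\<forall>x\<in>X. measure a {x} = m x" and "mass a = (\<Sum>x\<in>X. m x)"
proof -
  have em: "emeasure a {x} = ennreal (if x \<in> X then m x else 0)" for x
  proof -
    have "emeasure a {x} = (\<Sum>y\<in>X. ennreal (m y) * indicator {x} y)"
      using repr by simp
    also have "\<dots> = (\<Sum>y\<in>X. if y = x then ennreal (m y) else 0)"
      by (intro sum.cong) (auto simp: indicator_def)
    also have "\<dots> = ennreal (if x \<in> X then m x else 0)"
      using assms(1) by (simp add: sum.delta)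
    finally show ?thesis .
  qed
  have me: "measure a {x} = (if x \<in> X then m x else 0)" for x
    using em[of x] pos by (auto simp: measure_def intro: less_imp_le)
  show "atoms a = X" and "\<forall>x\<in>X. measure a {x} = m x"
    using pos by (auto simp: atoms_def me)
  have "emeasure a UNIV = (\<Sum>x\<in>X. ennreal (m x))"
    using repr by simp
  also have "\<dots> = ennreal (\<Sum>x\<in>X. m x)"
    using pos by (intro sum_ennreal) (auto intro: less_imp_le)
  finally show "mass a = (\<Sum>x\<in>X. m x)"
    using pos sum_nonneg[of X m] by (simp add: mass_def measure_def less_imp_le)
qed

section \<open>Transport paths\<close>

definition balanced_at ::
  "'v pair_pre_digraph \<Rightarrow> ('v \<times> 'v \<Rightarrow> real) \<Rightarrow> 'v \<Rightarrow> real \<Rightarrow> real \<Rightarrow> bool" where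
  "balanced_at G w v supply demand \<longleftrightarrow>
     (\<Sum>e\<in>{e \<in> parcs G. fst e = v}. w e) =
     (\<Sum>e\<in>{e \<in> parcs G. snd e = v}. w e) + supply - demand"

text \<open>
  The locale \<open>pair_digraph\<close> requires finitely many vertices and arcs, arcs between vertices
  of the graph, and no loops (a loop would be a degenerate segment of length zero).
  Off the atoms of \<open>a\<close> and \<open>b\<close>, the terms \<open>measure a {v}\<close> and \<open>measure b {v}\<close>
  vanish.
\<close>

definition transport_path ::
  "(real^'m) measure \<Rightarrow> (real^'m) measure \<Rightarrow>
   (real^'m) pair_pre_digraph \<Rightarrow> ((real^'m) \<times> (real^'m) \<Rightarrow> real) \<Rightarrow> bool" where
  "transport_path a b G w \<longleftrightarrow>
     atomic_measure a \<and> atomic_measure b \<and> mass a = mass b \<and>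
     pair_digraph G \<and>
     atoms a \<subseteq> pverts G \<and> atoms b \<subseteq> pverts G \<and>
     (\<forall>e\<in>parcs G. 0 < w e) \<and>
     (\<forall>v\<in>pverts G. balanced_at G w v (measure a {v}) (measure b {v}))"

text \<open>
  Transport paths for negative exponents: abstract vertices, which may be several copies of
  the same point, a position map \<open>pos\<close>, and maps \<open>s\<close> and \<open>t\<close> selecting the vertex that
  carries the source (sink) at an atom of \<open>a\<close> (of \<open>b\<close>). Natural numbers serve as
  vertices, since every finite graph is isomorphic to one with such vertices.
\<close>

definition unfolded_transport_path ::
  "(real^'m) measure \<Rightarrow> (real^'m) measure \<Rightarrow>
   nat pair_pre_digraph \<Rightarrow> (nat \<times> nat \<Rightarrow> real) \<Rightarrow> (nat \<Rightarrow> real^'m) \<Rightarrow>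
   (real^'m \<Rightarrow> nat) \<Rightarrow> (real^'m \<Rightarrow> nat) \<Rightarrow> bool" where
  "unfolded_transport_path a b G w pos s t \<longleftrightarrow>
     atomic_measure a \<and> atomic_measure b \<and> mass a = mass b \<and>
     pair_digraph G \<and> acyclic (parcs G) \<and>
     (\<forall>(u, v)\<in>parcs G. pos u \<noteq> pos v) \<and>
     (\<forall>x\<in>atoms a. s x \<in> pverts G \<and> pos (s x) = x) \<and>
     (\<forall>y\<in>atoms b. t y \<in> pverts G \<and> pos (t y) = y) \<and>
     (\<forall>e\<in>parcs G. 0 < w e) \<and>
     (\<forall>v\<in>pverts G. balanced_at G w v
        (if pos v \<in> atoms a \<and> s (pos v) = v then measure a {pos v} else 0)
        (if pos v \<in> atoms b \<and> t (pos v) = v then measure b {pos v} else 0))"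

definition M_cost ::
  "real \<Rightarrow> ('v \<Rightarrow> real^'m) \<Rightarrow> 'v pair_pre_digraph \<Rightarrow> ('v \<times> 'v \<Rightarrow> real) \<Rightarrow> real" where
  "M_cost \<alpha> pos G w = (\<Sum>(u, v)\<in>parcs G. w (u, v) powr \<alpha> * dist (pos u) (pos v))"

definition path_costs :: "real \<Rightarrow> (real^'m) measure \<Rightarrow> (real^'m) measure \<Rightarrow> real set" where
  "path_costs \<alpha> a b =
     (if \<alpha> < 0
      then {M_cost \<alpha> pos G w | G w pos s t. unfolded_transport_path a b G w pos s t}
      else {M_cost \<alpha> (\<lambda>x. x) G w | G w. transport_path a b G w})"

text \<open>
  The infimum is meant for atomic probability measures only. The value \<open>0\<close> elsewhere
  matters because the locale \<open>Metric_space\<close> asks for nonnegativity and symmetry of the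
  distance on the whole type, while \<open>Inf {}\<close> is unspecified for real numbers.
\<close>

definition d_alpha :: "real \<Rightarrow> (real^'m) measure \<Rightarrow> (real^'m) measure \<Rightarrow> real" where
  "d_alpha \<alpha> a b =
     (if a \<in> atomic_probability_measures \<and> b \<in> atomic_probability_measures
      then Inf (path_costs \<alpha> a b) else 0)"

end

theory Submission
  imports Defs
begin

text \<open>
  Since \<open>w powr \<alpha>\<close> is subadditive in \<open>w > 0\<close> for every \<open>\<alpha> \<le> 1\<close>, identifying vertices at the
  same point does not increase the cost, so abstract networks with arbitrary vertex types may be
  used for all exponents. Concatenation of networks gives the triangle inequality. Positivity
  comes from an atom \<open>x\<close> with more mass in \<open>a\<close> than in \<open>b\<close>: the excess crosses every small
  sphere around \<open>x\<close>, and either all crossing edges have weight \<open>w \<le> 1\<close>, so that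
  \<open>w powr \<alpha> \<ge> w\<close>, or \<open>\<alpha> \<ge> 0\<close> and one of them has \<open>w powr \<alpha> \<ge> 1\<close>.
\<close>

section \<open>Atomic probability measures\<close>

lemma atomic_probability_measuresD:
  assumes "a \<in> atomic_probability_measures"
  shows "atomic_measure a" and "mass a = 1" and "finite (atoms a)"
    and "(\<Sum>x\<in>atoms a. measure a {x}) = 1" and "sets a = sets borel"
    and "A \<in> sets borel \<Longrightarrow>
      emeasure a A = (\<Sum>x\<in>atoms a. ennreal (measure a {x}) * indicator A x)"
proof -
  from assms have at: "atomic_measure a" and m: "mass a = 1"
    by (auto simp: atomic_probability_measures_def)
  from at obtain X m where X: "finite X" "\<forall>x\<in>X. 0 < m x"
      "\<forall>A\<in>sets borel. emeasure a A = (\<Sum>x\<in>X. ennreal (m x) * indicator A x)"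
    and s: "sets a = sets borel"
    unfolding atomic_measure_def by blast
  note eq = atoms_eqI[OF X]
  show "atomic_measure a" "mass a = 1" "sets a = sets borel" "finite (atoms a)"
    using at m s X(1) eq(1) by auto
  show "(\<Sum>x\<in>atoms a. measure a {x}) = 1"
    using eq m by simp
  show "A \<in> sets borel \<Longrightarrow>
      emeasure a A = (\<Sum>x\<in>atoms a. ennreal (measure a {x}) * indicator A x)"
    using X(3) eq by simp
qed

lemma measure_pos_atoms: "x \<in> atoms a \<Longrightarrow> 0 < measure a {x}"
  by (simp add: atoms_def)

lemma measure_not_atoms: "x \<notin> atoms a \<Longrightarrow> measure a {x} = 0"
  using measure_nonneg[of a "{x}"] unfolding atoms_def by (auto simp: less_le)

lemma measure_singleton_le_1:
  assumes "a \<in> atomic_probability_measures"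
  shows "measure a {x} \<le> 1"
proof (cases "x \<in> atoms a")
  case True
  then have "measure a {x} \<le> (\<Sum>x\<in>atoms a. measure a {x})"
    using atomic_probability_measuresD(3)[OF assms] by (intro member_le_sum) auto
  then show ?thesis
    by (simp add: atomic_probability_measuresD(4)[OF assms])
qed (simp add: measure_not_atoms)

lemma atomic_probability_measures_eqI:
  assumes a: "a \<in> atomic_probability_measures" and b: "b \<in> atomic_probability_measures"
    and eq: "\<And>x. measure a {x} = measure b {x}"
  shows "a = b"
proof (rule measure_eqI)
  show "sets a = sets b"
    using atomic_probability_measuresD(5) a b by metis
  have "atoms a = atoms b"
    by (simp add: atoms_def eq)
  then show "emeasure a A = emeasure b A" if "A \<in> sets a" for A
    using that atomic_probability_measuresD(5)[OF a] atomic_probability_measuresD(6)[OF a, of A]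
      atomic_probability_measuresD(6)[OF b, of A] eq by simp
qed

text \<open>Both families of coefficients sum to 1. If those of \<open>a\<close> were dominated by
  those of \<open>b\<close>, the differences would be nonnegative with sum 0, hence all zero, and
  the measures would agree.\<close>

lemma ex_less_measure_singleton:
  assumes a: "a \<in> atomic_probability_measures" and b: "b \<in> atomic_probability_measures"
    and "a \<noteq> b"
  shows "\<exists>x. measure b {x} < measure a {x}"
proof (rule ccontr)
  assume "\<not> ?thesis"
  then have le: "measure a {x} \<le> measure b {x}" for x
    by (auto simp: not_less)
  let ?X = "atoms a \<union> atoms b"
  have fin: "finite ?X"
    using a b by (simp add: atomic_probability_measuresD)
  have "(\<Sum>x\<in>?X. measure a {x}) = (\<Sum>x\<in>atoms a. measure a {x})"
    using fin by (intro sum.mono_neutral_right) (auto simp: measure_not_atoms)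
  moreover have "(\<Sum>x\<in>?X. measure b {x}) = (\<Sum>x\<in>atoms b. measure b {x})"
    using fin by (intro sum.mono_neutral_right) (auto simp: measure_not_atoms)
  ultimately have "(\<Sum>x\<in>?X. measure b {x} - measure a {x}) = 0"
    using a b by (simp add: sum_subtractf atomic_probability_measuresD)
  then have "\<forall>x\<in>?X. measure b {x} - measure a {x} = 0"
    using fin le by (subst (asm) sum_nonneg_eq_0_iff) auto
  then have "measure a {x} = measure b {x}" for x
    using measure_not_atoms[of x a] measure_not_atoms[of x b] by fastforce
  with assms show False
    using atomic_probability_measures_eqI by blast
qed

section \<open>Networks\<close>

text \<open>
  The common form of both kinds of transport paths. The balance equations are stated in weak
  form, tested against all functions on the vertices; the choice of the test function
  then replaces any bookkeeping of the edges at a vertex.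
\<close>

definition network ::
  "(real^'m) measure \<Rightarrow> (real^'m) measure \<Rightarrow> ('v \<times> 'v) set \<Rightarrow> ('v \<times> 'v \<Rightarrow> real) \<Rightarrow>
   ('v \<Rightarrow> real^'m) \<Rightarrow> (real^'m \<Rightarrow> 'v) \<Rightarrow> (real^'m \<Rightarrow> 'v) \<Rightarrow> bool" where
  "network a b E w pos s t \<longleftrightarrow>
     finite E \<and> (\<forall>e\<in>E. pos (fst e) \<noteq> pos (snd e)) \<and> (\<forall>e\<in>E. 0 < w e) \<and>
     (\<forall>x\<in>atoms a. pos (s x) = x) \<and> (\<forall>y\<in>atoms b. pos (t y) = y) \<and>
     (\<forall>\<phi>. (\<Sum>e\<in>E. w e * (\<phi> (snd e) - \<phi> (fst e))) =
           (\<Sum>y\<in>atoms b. measure b {y} * \<phi> (t y)) - (\<Sum>x\<in>atoms a. measure a {x} * \<phi> (s x)))"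

definition edge_cost ::
  "real \<Rightarrow> ('v \<Rightarrow> real^'m) \<Rightarrow> ('v \<times> 'v) set \<Rightarrow> ('v \<times> 'v \<Rightarrow> real) \<Rightarrow> real" where
  "edge_cost \<alpha> pos E w = (\<Sum>e\<in>E. w e powr \<alpha> * dist (pos (fst e)) (pos (snd e)))"

lemma M_cost_eq_edge_cost: "M_cost \<alpha> pos G w = edge_cost \<alpha> pos (parcs G) w"
  by (simp add: M_cost_def edge_cost_def case_prod_beta)

lemma edge_cost_nonneg: "0 \<le> edge_cost \<alpha> pos E w"
  by (simp add: edge_cost_def sum_nonneg)

lemma networkD:
  assumes "network a b E w pos s t"
  shows "finite E" and "e \<in> E \<Longrightarrow> pos (fst e) \<noteq> pos (snd e)" and "e \<in> E \<Longrightarrow> 0 < w e"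
    and "x \<in> atoms a \<Longrightarrow> pos (s x) = x" and "y \<in> atoms b \<Longrightarrow> pos (t y) = y"
    and "(\<Sum>e\<in>E. w e * (\<phi> (snd e) - \<phi> (fst e))) =
      (\<Sum>y\<in>atoms b. measure b {y} * \<phi> (t y)) - (\<Sum>x\<in>atoms a. measure a {x} * \<phi> (s x))"
  using assms unfolding network_def by auto

text \<open>Every \<open>i\<close> lies in the fibre of exactly one \<open>v\<close>. This converts
  sums over vertices into sums over edges or atoms.\<close>

lemma sum_mult_fibre_sum:
  fixes f g :: "_ \<Rightarrow> real"
  assumes "finite V" "finite I" "h ` I \<subseteq> V"
  shows "(\<Sum>v\<in>V. f v * (\<Sum>i\<in>{i\<in>I. h i = v}. g i)) = (\<Sum>i\<in>I. g i * f (h i))"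
proof -
  have "(\<Sum>v\<in>V. f v * (\<Sum>i\<in>{i\<in>I. h i = v}. g i)) =
      (\<Sum>v\<in>V. \<Sum>i\<in>{i\<in>I. h i = v}. g i * f (h i))"
    unfolding sum_distrib_left by (intro sum.cong) (auto simp: mult.commute)
  also have "\<dots> = (\<Sum>i\<in>I. g i * f (h i))"
    using assms by (intro sum.group) auto
  finally show ?thesis .
qed

text \<open>\<open>pos\<close> inverts \<open>s\<close> on the atoms, so only the atom
  \<open>pos v\<close> can be sent to \<open>v\<close>. The right side is the conditional term of
  \<open>unfolded_transport_path\<close>.\<close>

lemma sum_marked_atom:
  assumes "finite (atoms a)" and "\<forall>x\<in>atoms a. pos (s x) = x"
  shows "(\<Sum>x\<in>{x\<in>atoms a. s x = v}. measure a {x}) =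
    (if pos v \<in> atoms a \<and> s (pos v) = v then measure a {pos v} else 0)"
proof -
  have "{x\<in>atoms a. s x = v} = (if pos v \<in> atoms a \<and> s (pos v) = v then {pos v} else {})"
    using assms(2) by auto
  then show ?thesis by simp
qed

text \<open>Summation by parts: multiplying the equation at \<open>v\<close> by
  \<open>\<phi> v\<close> and summing over \<open>V\<close> gives the weak form; indicators of
  single vertices recover the equations.\<close>

lemma weak_balance_iff:
  fixes w :: "'v \<times> 'v \<Rightarrow> real"
  assumes "finite V" "finite E" "finite (atoms a)" "finite (atoms b)"
    and "fst ` E \<subseteq> V" "snd ` E \<subseteq> V" "s ` atoms a \<subseteq> V" "t ` atoms b \<subseteq> V"
  shows "(\<forall>\<phi>. (\<Sum>e\<in>E. w e * (\<phi> (snd e) - \<phi> (fst e))) =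
           (\<Sum>y\<in>atoms b. measure b {y} * \<phi> (t y)) - (\<Sum>x\<in>atoms a. measure a {x} * \<phi> (s x))) \<longleftrightarrow>
    (\<forall>v\<in>V. (\<Sum>e\<in>{e\<in>E. fst e = v}. w e) = (\<Sum>e\<in>{e\<in>E. snd e = v}. w e) +
       (\<Sum>x\<in>{x\<in>atoms a. s x = v}. measure a {x}) - (\<Sum>y\<in>{y\<in>atoms b. t y = v}. measure b {y}))"
    (is "(\<forall>\<phi>. ?L \<phi> = ?R \<phi>) \<longleftrightarrow> (\<forall>v\<in>V. ?out v = ?inn v + ?s v - ?t v)")
proof -
  have key: "(\<Sum>v\<in>V. \<phi> v * (?inn v + ?s v - ?t v - ?out v)) = ?L \<phi> - ?R \<phi>" for \<phi> :: "'v \<Rightarrow> real"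
    using sum_mult_fibre_sum[OF assms(1,2,5), of \<phi> w] sum_mult_fibre_sum[OF assms(1,2,6), of \<phi> w]
      sum_mult_fibre_sum[OF assms(1,3,7), of \<phi> "\<lambda>x. measure a {x}"]
      sum_mult_fibre_sum[OF assms(1,4,8), of \<phi> "\<lambda>x. measure b {x}"]
    by (simp add: distrib_left right_diff_distrib sum.distrib sum_subtractf)
  show ?thesis
  proof (intro iffI allI ballI)
    fix v assume L: "\<forall>\<phi>. ?L \<phi> = ?R \<phi>" and v: "v \<in> V"
    have "(\<Sum>u\<in>V. of_bool (u = v) * (?inn u + ?s u - ?t u - ?out u)) = 0"
      using key[of "\<lambda>u. of_bool (u = v)"] L[THEN spec, of "\<lambda>u. of_bool (u = v)"] by simp
    moreover have "(\<Sum>u\<in>V. of_bool (u = v) * (?inn u + ?s u - ?t u - ?out u)) =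
        (\<Sum>u\<in>V. if u = v then ?inn u + ?s u - ?t u - ?out u else 0)"
      by (intro sum.cong) auto
    ultimately show "?out v = ?inn v + ?s v - ?t v"
      using v assms(1) by (simp add: sum.delta)
  next
    fix \<phi> assume "\<forall>v\<in>V. ?out v = ?inn v + ?s v - ?t v"
    then have "(\<Sum>v\<in>V. \<phi> v * (?inn v + ?s v - ?t v - ?out v)) = 0"
      by (intro sum.neutral) auto
    then show "?L \<phi> = ?R \<phi>"
      unfolding key by simp
  qed
qed

section \<open>Passage between transport paths and networks\<close>

lemma transport_path_network:
  fixes a b :: "(real^'m) measure"
  assumes a: "a \<in> atomic_probability_measures" and b: "b \<in> atomic_probability_measures"
    and T: "transport_path a b G w"
  shows "network a b (parcs G) w (\<lambda>x. x) (\<lambda>x. x) (\<lambda>x. x)"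
proof -
  from T have G: "pair_digraph G" and V: "atoms a \<subseteq> pverts G" "atoms b \<subseteq> pverts G"
    and w: "\<forall>e\<in>parcs G. 0 < w e"
    and bal: "\<forall>v\<in>pverts G. balanced_at G w v (measure a {v}) (measure b {v})"
    by (auto simp: transport_path_def)
  interpret pair_digraph G by fact
  have E: "fst ` parcs G \<subseteq> pverts G" "snd ` parcs G \<subseteq> pverts G"
    using arc_fst_in_verts arc_snd_in_verts by blast+
  have fin: "finite (atoms a)" "finite (atoms b)"
    using a b by (simp_all add: atomic_probability_measuresD)
  have "(\<Sum>x | x = v \<and> x \<in> atoms c. measure c {x}) = measure c {v}"
    if "finite (atoms c)" for c :: "(real^'m) measure" and v
    using sum_marked_atom[OF that, of "\<lambda>x. x" "\<lambda>x. x" v]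
    by (simp add: measure_not_atoms conj_commute)
  then show ?thesis
    unfolding network_def
    using w fin bal V pair_no_loops pair_finite_arcs E
    by (subst weak_balance_iff[OF pair_finite_verts])
      (auto simp: balanced_at_def)
qed

lemma unfolded_transport_path_network:
  assumes a: "a \<in> atomic_probability_measures" and b: "b \<in> atomic_probability_measures"
    and T: "unfolded_transport_path a b G w pos s t"
  shows "network a b (parcs G) w pos s t" and "acyclic (parcs G)"
proof -
  from T have G: "pair_digraph G" and p: "\<forall>(u, v)\<in>parcs G. pos u \<noteq> pos v"
    and s: "\<forall>x\<in>atoms a. s x \<in> pverts G \<and> pos (s x) = x"
    and t: "\<forall>y\<in>atoms b. t y \<in> pverts G \<and> pos (t y) = y"
    and w: "\<forall>e\<in>parcs G. 0 < w e"
    and bal: "\<forall>v\<in>pverts G. balanced_at G w v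
        (if pos v \<in> atoms a \<and> s (pos v) = v then measure a {pos v} else 0)
        (if pos v \<in> atoms b \<and> t (pos v) = v then measure b {pos v} else 0)"
    and ac: "acyclic (parcs G)"
    by (auto simp: unfolded_transport_path_def)
  interpret pair_digraph G by fact
  have E: "fst ` parcs G \<subseteq> pverts G" "snd ` parcs G \<subseteq> pverts G"
    using arc_fst_in_verts arc_snd_in_verts by blast+
  have fin: "finite (atoms a)" "finite (atoms b)"
    using a b by (simp_all add: atomic_probability_measuresD)
  have "\<forall>x\<in>atoms a. pos (s x) = x" "\<forall>x\<in>atoms b. pos (t x) = x"
    using s t by auto
  note sm = sum_marked_atom[where pos = pos and s = s, OF fin(1) this(1)]
    sum_marked_atom[where pos = pos and s = t, OF fin(2) this(2)]
  show "network a b (parcs G) w pos s t"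
    unfolding network_def
    using w fin bal s t p pair_finite_arcs E
    by (subst weak_balance_iff[OF pair_finite_verts])
      (auto simp: balanced_at_def sm)
  show "acyclic (parcs G)" by fact
qed

lemma pair_digraphI:
  assumes "finite V" "finite E" "fst ` E \<subseteq> V" "snd ` E \<subseteq> V" "\<And>e. e \<in> E \<Longrightarrow> fst e \<noteq> snd e"
  shows "pair_digraph \<lparr>pverts = V, parcs = E\<rparr>"
  using assms by unfold_locales (auto simp: image_subset_iff)

text \<open>A \<open>network\<close> carries no vertex set; the endpoints of its edges together with
  the atoms supply one. With the identity as position map, \<open>s\<close> and \<open>t\<close> fix
  every atom.\<close>

lemma network_transport_path:
  assumes a: "a \<in> atomic_probability_measures" and b: "b \<in> atomic_probability_measures"
    and N: "network a b E w (\<lambda>x. x) s t"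
  shows "\<exists>V. transport_path a b \<lparr>pverts = V, parcs = E\<rparr> w"
proof -
  let ?V = "fst ` E \<union> snd ` E \<union> atoms a \<union> atoms b"
  have fin: "finite (atoms a)" "finite (atoms b)"
    using a b by (simp_all add: atomic_probability_measuresD)
  have s: "\<forall>x\<in>atoms a. s x = x" and t: "\<forall>x\<in>atoms b. t x = x"
    using networkD(4,5)[OF N] by auto
  have "finite ?V"
    using fin networkD(1)[OF N] by auto
  moreover have "\<forall>v\<in>?V. (\<Sum>e\<in>{e\<in>E. fst e = v}. w e) = (\<Sum>e\<in>{e\<in>E. snd e = v}. w e) +
       (\<Sum>x\<in>{x\<in>atoms a. s x = v}. measure a {x}) - (\<Sum>y\<in>{y\<in>atoms b. t y = v}. measure b {y})"
    using fin networkD(1,6)[OF N] s t by (subst weak_balance_iff[symmetric]) auto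
  moreover have "(\<Sum>x\<in>{x\<in>atoms a. s x = v}. measure a {x}) = measure a {v}" for v
    using sum_marked_atom[where pos = "\<lambda>x. x" and s = s, OF fin(1) s] s by (auto simp: measure_not_atoms)
  moreover have "(\<Sum>x\<in>{x\<in>atoms b. t x = v}. measure b {x}) = measure b {v}" for v
    using sum_marked_atom[where pos = "\<lambda>x. x" and s = t, OF fin(2) t] t by (auto simp: measure_not_atoms)
  ultimately have "transport_path a b \<lparr>pverts = ?V, parcs = E\<rparr> w"
    using a b networkD(1,2,3)[OF N]
    by (auto simp: transport_path_def balanced_at_def atomic_probability_measuresD
      intro!: pair_digraphI)
  then show ?thesis ..
qed

lemma network_unfolded_transport_path:
  assumes a: "a \<in> atomic_probability_measures" and b: "b \<in> atomic_probability_measures"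
    and N: "network a b E w pos s t" and ac: "acyclic E"
  shows "\<exists>V. unfolded_transport_path a b \<lparr>pverts = V, parcs = E\<rparr> w pos s t"
proof -
  let ?V = "fst ` E \<union> snd ` E \<union> s ` atoms a \<union> t ` atoms b"
  have fin: "finite (atoms a)" "finite (atoms b)"
    using a b by (simp_all add: atomic_probability_measuresD)
  have s: "\<forall>x\<in>atoms a. pos (s x) = x" and t: "\<forall>x\<in>atoms b. pos (t x) = x"
    using networkD(4,5)[OF N] by auto
  have "finite ?V"
    using fin networkD(1)[OF N] by auto
  moreover have "\<forall>v\<in>?V. (\<Sum>e\<in>{e\<in>E. fst e = v}. w e) = (\<Sum>e\<in>{e\<in>E. snd e = v}. w e) +
       (\<Sum>x\<in>{x\<in>atoms a. s x = v}. measure a {x}) - (\<Sum>y\<in>{y\<in>atoms b. t y = v}. measure b {y})"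
    using fin networkD(1,6)[OF N] by (subst weak_balance_iff[symmetric]) auto
  moreover have "fst e \<noteq> snd e" if "e \<in> E" for e
    using networkD(2)[OF N that] by auto
  ultimately have "unfolded_transport_path a b \<lparr>pverts = ?V, parcs = E\<rparr> w pos s t"
    unfolding sum_marked_atom[where pos = pos and s = s, OF fin(1) s]
      sum_marked_atom[where pos = pos and s = t, OF fin(2) t]
    using a b ac s t networkD(1,2,3)[OF N]
    by (auto simp: unfolded_transport_path_def balanced_at_def atomic_probability_measuresD
        intro!: pair_digraphI)
  then show ?thesis ..
qed

section \<open>Operations on networks\<close>

text \<open>Write \<open>S\<close> for the sum. Then \<open>S powr \<alpha>\<close> is the sum of
  the \<open>w i * S powr (\<alpha> - 1)\<close>, and
  \<open>S powr (\<alpha> - 1) \<le> w i powr (\<alpha> - 1)\<close> because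
  \<open>w i \<le> S\<close> and the exponent is nonpositive.\<close>

lemma powr_sum_le_sum_powr:
  fixes w :: "'i \<Rightarrow> real"
  assumes "finite I" "\<And>i. i \<in> I \<Longrightarrow> 0 < w i" "\<alpha> \<le> 1"
  shows "(\<Sum>i\<in>I. w i) powr \<alpha> \<le> (\<Sum>i\<in>I. w i powr \<alpha>)"
proof (cases "I = {}")
  case False
  let ?S = "\<Sum>i\<in>I. w i"
  have pos: "0 < ?S"
    using assms False by (intro sum_pos) auto
  have "?S powr \<alpha> = ?S * ?S powr (\<alpha> - 1)"
    using pos by (simp add: powr_diff)
  also have "\<dots> = (\<Sum>i\<in>I. w i * ?S powr (\<alpha> - 1))"
    by (simp add: sum_distrib_right)
  also have "\<dots> \<le> (\<Sum>i\<in>I. w i powr \<alpha>)"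
  proof (rule sum_mono)
    fix i assume i: "i \<in> I"
    have "w i \<le> ?S"
      using i assms by (intro member_le_sum) (auto simp: less_imp_le)
    then have "w i * ?S powr (\<alpha> - 1) \<le> w i * w i powr (\<alpha> - 1)"
      using assms(2)[OF i] assms(3) by (intro mult_left_mono powr_mono2') auto
    also have "\<dots> = w i powr \<alpha>"
      using assms(2)[OF i] by (simp add: powr_diff)
    finally show "w i * ?S powr (\<alpha> - 1) \<le> w i powr \<alpha>" .
  qed
  finally show ?thesis .
qed simp

text \<open>Relabelling by \<open>f\<close> adds the weights of edges that become equal. A test
  function \<open>\<phi>\<close> pulls back to \<open>\<phi> \<circ> f\<close>, and subadditivity of
  the power bounds the cost. \<open>f\<close> may merge vertices, but only at equal positions, so no
  edge degenerates.\<close>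

lemma network_pushforward:
  fixes f :: "'v \<Rightarrow> 'u"
  assumes N: "network a b E w pos s t" and "\<alpha> \<le> 1"
    and p: "\<And>v. v \<in> fst ` E \<union> snd ` E \<union> s ` atoms a \<union> t ` atoms b \<Longrightarrow> pos' (f v) = pos v"
  defines "F \<equiv> map_prod f f"
  defines "w' \<equiv> \<lambda>e'. \<Sum>e\<in>{e\<in>E. F e = e'}. w e"
  shows "network a b (F ` E) w' pos' (f \<circ> s) (f \<circ> t)"
    and "edge_cost \<alpha> pos' (F ` E) w' \<le> edge_cost \<alpha> pos E w"
proof -
  note N' = networkD[OF N]
  have pf: "pos' (f (fst e)) = pos (fst e)" "pos' (f (snd e)) = pos (snd e)" if "e \<in> E" for e
    using that by (auto intro!: p)
  have F: "fst (F e) = f (fst e)" "snd (F e) = f (snd e)" for e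
    by (simp_all add: F_def)
  have sum_w': "(\<Sum>e'\<in>F ` E. w' e' * g e') = (\<Sum>e\<in>E. w e * g (F e))" for g
    using sum_mult_fibre_sum[of "F ` E" E F g w] N'(1) by (simp add: w'_def mult.commute)
  have "0 < w' e'" if "e' \<in> F ` E" for e'
    unfolding w'_def using that N'(1,3) by (intro sum_pos) auto
  moreover have "(\<Sum>e\<in>F ` E. w' e * (\<phi> (snd e) - \<phi> (fst e))) =
      (\<Sum>y\<in>atoms b. measure b {y} * \<phi> ((f \<circ> t) y)) -
      (\<Sum>x\<in>atoms a. measure a {x} * \<phi> ((f \<circ> s) x))" for \<phi>
    unfolding sum_w' using N'(6)[of "\<phi> \<circ> f"] by (simp add: F)
  ultimately show "network a b (F ` E) w' pos' (f \<circ> s) (f \<circ> t)"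
    using N'(1,2,4,5) by (auto simp: network_def F pf p)
  have "edge_cost \<alpha> pos' (F ` E) w' \<le>
      (\<Sum>e'\<in>F ` E. dist (pos' (fst e')) (pos' (snd e')) * (\<Sum>e\<in>{e\<in>E. F e = e'}. w e powr \<alpha>))"
    unfolding edge_cost_def w'_def using N'(1,3) assms(2)
    by (subst mult.commute, intro sum_mono mult_left_mono powr_sum_le_sum_powr) auto
  also have "\<dots> = (\<Sum>e\<in>E. w e powr \<alpha> * dist (pos' (fst (F e))) (pos' (snd (F e))))"
    using N'(1) by (intro sum_mult_fibre_sum) auto
  also have "\<dots> = edge_cost \<alpha> pos E w"
    unfolding edge_cost_def by (intro sum.cong) (simp_all add: F pf)
  finally show "edge_cost \<alpha> pos' (F ` E) w' \<le> edge_cost \<alpha> pos E w" .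
qed

section \<open>Acyclicity through rank functions\<close>

lemma acyclic_if_rank:
  fixes \<rho> :: "'v \<Rightarrow> nat"
  assumes "\<And>e. e \<in> E \<Longrightarrow> \<rho> (fst e) < \<rho> (snd e)"
  shows "acyclic E"
proof -
  have "E \<subseteq> inv_image less_than \<rho>"
    using assms by auto
  then show ?thesis
    using wf_acyclic wf_subset[OF wf_inv_image[OF wf_less_than]] by blast
qed

text \<open>The rank counts proper ancestors: along an edge the ancestors of the tail remain
  ancestors of the head, and the tail itself is new, since acyclicity forbids it to be its own
  ancestor.\<close>

lemma acyclic_rank:
  fixes E :: "('v \<times> 'v) set"
  assumes "finite E" "acyclic E"
  obtains \<rho> :: "'v \<Rightarrow> nat" where "\<And>e. e \<in> E \<Longrightarrow> \<rho> (fst e) < \<rho> (snd e)"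
proof
  fix e assume "e \<in> E"
  obtain u v where uv: "e = (u, v)"
    by (cases e)
  with \<open>e \<in> E\<close> have E: "(u, v) \<in> E"
    by simp
  define D where "D = (\<lambda>v. {u. (u, v) \<in> E\<^sup>+})"
  have "D u \<subseteq> D v"
    using E by (auto simp: D_def intro: trancl_into_trancl)
  moreover have "u \<in> D v" "u \<notin> D u"
    using E assms(2) by (auto simp: D_def acyclic_def)
  ultimately have "D u \<subset> D v"
    by auto
  moreover have "D v \<subseteq> Domain (E\<^sup>+)"
    unfolding D_def by blast
  then have "finite (D v)"
    using assms(1) finite_subset by (metis finite_Domain finite_trancl)
  ultimately show "card {u. (u, fst e) \<in> E\<^sup>+} < card {u. (u, snd e) \<in> E\<^sup>+}"
    using psubset_card_mono unfolding D_def uv by simp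
qed

text \<open>A rank pulled back along the inverse of \<open>f\<close> ranks the image. Merging
  vertices could close a cycle, hence injectivity.\<close>

lemma acyclic_map_prod_image:
  fixes f :: "'v \<Rightarrow> 'u"
  assumes "finite E" "acyclic E" "inj_on f V" "fst ` E \<subseteq> V" "snd ` E \<subseteq> V"
  shows "acyclic (map_prod f f ` E)"
proof -
  obtain \<rho> :: "'v \<Rightarrow> nat" where \<rho>: "\<And>e. e \<in> E \<Longrightarrow> \<rho> (fst e) < \<rho> (snd e)"
    using acyclic_rank[OF assms(1,2)] by blast
  have inv: "the_inv_into V f (f (fst e)) = fst e" "the_inv_into V f (f (snd e)) = snd e" if "e \<in> E" for e
    using that assms(3,4,5) by (auto intro!: the_inv_into_f_f)
  show ?thesis
  proof (rule acyclic_if_rank[where \<rho> = "\<lambda>v. \<rho> (the_inv_into V f v)"])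
    fix e' assume "e' \<in> map_prod f f ` E"
    then obtain e where "e \<in> E" "e' = map_prod f f e" ..
    then show "\<rho> (the_inv_into V f (fst e')) < \<rho> (the_inv_into V f (snd e'))"
      using \<rho> by (simp add: inv)
  qed
qed

text \<open>The constructions below live on sum and product types, whereas
  \<open>unfolded_transport_path\<close> has natural numbers as vertices; an injective numbering of
  the finitely many vertices in use bridges the gap.\<close>

lemma network_nat:
  fixes E :: "('v \<times> 'v) set"
  assumes a: "a \<in> atomic_probability_measures" and b: "b \<in> atomic_probability_measures"
    and N: "network a b E w pos s t" and "\<alpha> \<le> 1"
  shows "\<exists>(E' :: (nat \<times> nat) set) w' pos' s' t'. network a b E' w' pos' s' t' \<and>
    (acyclic E \<longrightarrow> acyclic E') \<and> edge_cost \<alpha> pos' E' w' \<le> edge_cost \<alpha> pos E w"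
proof -
  define V where "V = fst ` E \<union> snd ` E \<union> s ` atoms a \<union> t ` atoms b"
  have "finite V"
    using networkD(1)[OF N] a b by (simp add: V_def atomic_probability_measuresD)
  from finite_imp_inj_to_nat_seg[OF this] obtain f :: "'v \<Rightarrow> nat" where f: "inj_on f V"
    by auto
  have p: "(pos \<circ> the_inv_into V f) (f v) = pos v"
    if "v \<in> fst ` E \<union> snd ` E \<union> s ` atoms a \<union> t ` atoms b" for v
    using the_inv_into_f_f[OF f, of v] that by (simp add: V_def)
  have "acyclic (map_prod f f ` E)" if "acyclic E"
    using that f by (intro acyclic_map_prod_image[OF networkD(1)[OF N]]) (auto simp: V_def)
  with network_pushforward[OF N \<open>\<alpha> \<le> 1\<close>, of "pos \<circ> the_inv_into V f" f, OF p]
  show ?thesis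
    by (intro exI conjI impI) assumption+
qed

section \<open>Comparison of path costs with network costs\<close>

lemma path_costs_network:
  assumes a: "a \<in> atomic_probability_measures" and b: "b \<in> atomic_probability_measures"
    and c: "c \<in> path_costs \<alpha> a b" and "\<alpha> \<le> 1"
  shows "\<exists>(E :: (nat \<times> nat) set) w pos s t. network a b E w pos s t \<and>
    (\<alpha> < 0 \<longrightarrow> acyclic E) \<and> edge_cost \<alpha> pos E w \<le> c"
proof (cases "\<alpha> < 0")
  case True
  then obtain G w pos s t where T: "unfolded_transport_path a b G w pos s t"
    and "c = M_cost \<alpha> pos G w"
    using c by (auto simp: path_costs_def)
  then show ?thesis
    using unfolded_transport_path_network[OF a b T] unfolding M_cost_eq_edge_cost by blast
next
  case False
  then obtain G w where T: "transport_path a b G w" and "c = M_cost \<alpha> (\<lambda>x. x) G w"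
    using c by (auto simp: path_costs_def)
  then show ?thesis
    using network_nat[OF a b transport_path_network[OF a b T] \<open>\<alpha> \<le> 1\<close>] False
    unfolding M_cost_eq_edge_cost by blast
qed

text \<open>Together with \<open>path_costs_network\<close>, this allows the infimum of
  \<open>path_costs\<close> to be estimated by networks; inequalities between costs suffice for
  that.\<close>

lemma network_path_costs:
  assumes a: "a \<in> atomic_probability_measures" and b: "b \<in> atomic_probability_measures"
    and N: "network a b E w pos s t" and ac: "\<alpha> < 0 \<longrightarrow> acyclic E" and "\<alpha> \<le> 1"
  shows "\<exists>c\<in>path_costs \<alpha> a b. c \<le> edge_cost \<alpha> pos E w"
proof (cases "\<alpha> < 0")
  case True
  with ac network_nat[OF a b N \<open>\<alpha> \<le> 1\<close>]
  obtain E' :: "(nat \<times> nat) set" and w' pos' s' t'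
    where N': "network a b E' w' pos' s' t'" "acyclic E'"
      and le: "edge_cost \<alpha> pos' E' w' \<le> edge_cost \<alpha> pos E w"
    by blast
  from network_unfolded_transport_path[OF a b N'] obtain V
    where "unfolded_transport_path a b \<lparr>pverts = V, parcs = E'\<rparr> w' pos' s' t'" ..
  then have "M_cost \<alpha> pos' \<lparr>pverts = V, parcs = E'\<rparr> w' \<in> path_costs \<alpha> a b"
    unfolding path_costs_def if_P[OF True] by blast
  then show ?thesis
    using le unfolding M_cost_eq_edge_cost by auto
next
  case False
  \<comment> \<open>Pushing forward along \<open>pos\<close> merges all vertices at the same point.
    Directed cycles may arise, but \<open>transport_path\<close> permits them.\<close>
  from network_pushforward[OF N \<open>\<alpha> \<le> 1\<close>, of "\<lambda>x. x" pos] obtain E' w' s' t'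
    where N': "network a b E' w' (\<lambda>x. x) s' t'"
      and le: "edge_cost \<alpha> (\<lambda>x. x) E' w' \<le> edge_cost \<alpha> pos E w"
    by blast
  from network_transport_path[OF a b N'] obtain V
    where "transport_path a b \<lparr>pverts = V, parcs = E'\<rparr> w'" ..
  then have "M_cost \<alpha> (\<lambda>x. x) \<lparr>pverts = V, parcs = E'\<rparr> w' \<in> path_costs \<alpha> a b"
    using False by (auto simp: path_costs_def)
  then show ?thesis
    using le unfolding M_cost_eq_edge_cost by auto
qed

section \<open>Reversed, empty, hub and concatenated networks\<close>

lemma network_reverse:
  assumes N: "network a b E w pos s t"
  shows "network b a (E\<inverse>) (w \<circ> prod.swap) pos t s"
    and "edge_cost \<alpha> pos (E\<inverse>) (w \<circ> prod.swap) = edge_cost \<alpha> pos E w"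
proof -
  note N' = networkD[OF N]
  have eq: "E\<inverse> = prod.swap ` E"
    by force
  have sum: "(\<Sum>e\<in>E\<inverse>. g e) = (\<Sum>e\<in>E. g (prod.swap e))" for g :: "_ \<Rightarrow> real"
    unfolding eq by (subst sum.reindex) auto
  \<comment> \<open>Reversing every edge flips the sign of the weak equation, which exchanges
    sources and sinks.\<close>
  have "(\<Sum>e\<in>E\<inverse>. (w \<circ> prod.swap) e * (\<phi> (snd e) - \<phi> (fst e))) =
      - (\<Sum>e\<in>E. w e * (\<phi> (snd e) - \<phi> (fst e)))" for \<phi> :: "_ \<Rightarrow> real"
    unfolding sum by (simp add: sum_negf[symmetric] algebra_simps)
  moreover have "finite (E\<inverse>)" "\<forall>e\<in>E\<inverse>. pos (fst e) \<noteq> pos (snd e)"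
    "\<forall>e\<in>E\<inverse>. 0 < (w \<circ> prod.swap) e"
    using N'(1,2,3) by (force simp: eq)+
  ultimately show "network b a (E\<inverse>) (w \<circ> prod.swap) pos t s"
    using N'(4,5,6) by (simp add: network_def)
  show "edge_cost \<alpha> pos (E\<inverse>) (w \<circ> prod.swap) = edge_cost \<alpha> pos E w"
    unfolding edge_cost_def sum by (simp add: dist_commute)
qed

lemma network_self: "network a a {} w (\<lambda>x. x) (\<lambda>x. x) (\<lambda>x. x)"
  by (simp add: network_def)

text \<open>Supplies a competitor, so that the infimum runs over a nonempty set. All mass runs to a
  point \<open>h\<close> and on to \<open>b\<close>; \<open>h\<close> balances since both masses are
  1. It avoids all atoms, so every edge has positive length, and the levels 0, 1, 2 serve as a
  rank.\<close>

lemma network_through_hub: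
  fixes a b :: "(real^'m) measure"
  assumes a: "a \<in> atomic_probability_measures" and b: "b \<in> atomic_probability_measures"
  shows "\<exists>(E :: ((real^'m) \<times> nat) rel) w s t. network a b E w fst s t \<and> acyclic E"
proof -
  have fin: "finite (atoms a)" "finite (atoms b)"
    using a b by (simp_all add: atomic_probability_measuresD)
  then have "\<exists>h. h \<notin> atoms a \<union> atoms b"
    by (intro ex_new_if_finite infinite_UNIV_char_0) auto
  then obtain h where h: "h \<notin> atoms a" "h \<notin> atoms b"
    by auto
  define i where "i = (\<lambda>x :: real^'m. ((x, 0::nat), (h, 1::nat)))"
  define j where "j = (\<lambda>y :: real^'m. ((h, 1::nat), (y, 2::nat)))"
  define E where "E = i ` atoms a \<union> j ` atoms b"
  \<comment> \<open>Level 0 at the tail means an edge from an atom of \<open>a\<close> to the hub;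
    every other edge of \<open>E\<close> ends at an atom of \<open>b\<close>.\<close>
  define w where "w = (\<lambda>e. if snd (fst e) = (0::nat) then measure a {fst (fst e)}
    else measure b {fst (snd e :: (real^'m) \<times> nat)})"
  have disj: "i ` atoms a \<inter> j ` atoms b = {}" and inj: "inj_on i (atoms a)" "inj_on j (atoms b)"
    by (auto simp: i_def j_def inj_on_def)
  have "(\<Sum>e\<in>E. w e * (\<phi> (snd e) - \<phi> (fst e))) =
      (\<Sum>y\<in>atoms b. measure b {y} * \<phi> (y, 2)) - (\<Sum>x\<in>atoms a. measure a {x} * \<phi> (x, 0))"
    for \<phi> :: "(real^'m) \<times> nat \<Rightarrow> real"
  proof -
    have "(\<Sum>e\<in>E. w e * (\<phi> (snd e) - \<phi> (fst e))) =
        (\<Sum>x\<in>atoms a. measure a {x} * (\<phi> (h, 1) - \<phi> (x, 0))) +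
        (\<Sum>y\<in>atoms b. measure b {y} * (\<phi> (y, 2) - \<phi> (h, 1)))"
      unfolding E_def using fin disj inj
      by (subst sum.union_disjoint) (auto simp: sum.reindex i_def j_def w_def)
    then show ?thesis
      by (simp add: right_diff_distrib sum_subtractf sum_distrib_right[symmetric]
          atomic_probability_measuresD(4)[OF a] atomic_probability_measuresD(4)[OF b])
  qed
  then have "network a b E w fst (\<lambda>x. (x, 0)) (\<lambda>y. (y, 2))"
    using fin h by (auto simp: network_def E_def i_def j_def w_def measure_pos_atoms)
  moreover have "acyclic E"
    by (rule acyclic_if_rank[where \<rho> = snd]) (auto simp: E_def i_def j_def)
  ultimately show ?thesis
    by blast
qed

text \<open>
  Identifying \<open>t\<^sub>1 y\<close> with \<open>s\<^sub>2 y\<close> could create directed cycles. Routing the mass at \<open>y\<close>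
  through a detour point at distance \<open>norm u\<close> from \<open>y\<close> keeps the two networks apart, at a cost
  that tends to zero with \<open>norm u\<close>.
\<close>

lemma network_concat:
  fixes a b c :: "(real^'m) measure" and u :: "real^'m"
  assumes b: "b \<in> atomic_probability_measures"
    and N1: "network a b (E1 :: ('v \<times> 'v) set) w1 pos1 s1 t1"
    and N2: "network b c (E2 :: ('u \<times> 'u) set) w2 pos2 s2 t2"
    and u: "u \<noteq> 0"
  shows "\<exists>(E :: ('v + real^'m + 'u) rel) w pos s t. network a c E w pos s t \<and>
    (acyclic E1 \<and> acyclic E2 \<longrightarrow> acyclic E) \<and>
    edge_cost \<alpha> pos E w =
      edge_cost \<alpha> pos1 E1 w1 + edge_cost \<alpha> pos2 E2 w2 +
      2 * norm u * (\<Sum>y\<in>atoms b. measure b {y} powr \<alpha>)"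
proof -
  note N1' = networkD[OF N1] and N2' = networkD[OF N2]
  have fb: "finite (atoms b)"
    using b by (simp add: atomic_probability_measuresD)
  define p :: "'v \<Rightarrow> 'v + real^'m + 'u" where "p = Inl"
  define q :: "real^'m \<Rightarrow> 'v + real^'m + 'u" where "q = Inr \<circ> Inl"
  define r :: "'u \<Rightarrow> 'v + real^'m + 'u" where "r = Inr \<circ> Inr"
  define pos where "pos = case_sum pos1 (case_sum (\<lambda>y. y + u) pos2)"
  \<comment> \<open>The weight is read off the endpoints: on the edge from \<open>p (t1 y)\<close>
    to \<open>q y\<close> the atom is recovered as \<open>pos1 (t1 y) = y\<close>. The incomplete
    inner \<open>case\<close> is met only by edges inside the \<open>r\<close> copy.\<close>
  define w :: "('v + real^'m + 'u) \<times> ('v + real^'m + 'u) \<Rightarrow> real" where "w = (\<lambda>(x, y). case x of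
      Inl v \<Rightarrow> (case y of Inl v' \<Rightarrow> w1 (v, v') | Inr z \<Rightarrow> measure b {pos1 v})
    | Inr z \<Rightarrow> (case z of Inl x \<Rightarrow> measure b {x}
        | Inr v \<Rightarrow> w2 (v, (case y of Inr (Inr v') \<Rightarrow> v'))))"
  define i where "i = (\<lambda>y. (p (t1 y), q y))"
  define j where "j = (\<lambda>y. (q y, r (s2 y)))"
  define E where "E = map_prod p p ` E1 \<union> i ` atoms b \<union> j ` atoms b \<union> map_prod r r ` E2"
  have inj: "inj_on (map_prod p p) E1" "inj_on (map_prod r r) E2"
    "inj_on i (atoms b)" "inj_on j (atoms b)"
    by (auto simp: inj_on_def p_def q_def r_def i_def j_def)
  have sum_E: "(\<Sum>e\<in>E. g e) = (\<Sum>e\<in>E1. g (map_prod p p e)) + (\<Sum>y\<in>atoms b. g (i y)) +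
      (\<Sum>y\<in>atoms b. g (j y)) + (\<Sum>e\<in>E2. g (map_prod r r e))" for g :: "_ \<Rightarrow> real"
  proof -
    have "map_prod p p ` E1 \<inter> i ` atoms b = {}"
      "(map_prod p p ` E1 \<union> i ` atoms b) \<inter> j ` atoms b = {}"
      "(map_prod p p ` E1 \<union> i ` atoms b \<union> j ` atoms b) \<inter> map_prod r r ` E2 = {}"
      by (auto simp: p_def q_def r_def i_def j_def)
    then show ?thesis
      unfolding E_def using fb N1'(1) N2'(1) inj
      by (simp add: sum.union_disjoint sum.reindex)
  qed
  have w: "w (map_prod p p e) = w1 e" "w (map_prod r r e') = w2 e'"
    "y \<in> atoms b \<Longrightarrow> w (i y) = measure b {y}" "w (j y) = measure b {y}" for e e' y
    by (simp_all add: w_def i_def j_def p_def q_def r_def N1'(5) map_prod_def case_prod_beta)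
  have pos: "pos (p v) = pos1 v" "pos (q y) = y + u" "pos (r v') = pos2 v'" for v y v'
    by (auto simp: pos_def p_def q_def r_def)
  \<comment> \<open>Tested with \<open>\<phi> \<circ> p\<close> and \<open>\<phi> \<circ> r\<close>,
    the two networks leave terms at \<open>t1 y\<close> and \<open>s2 y\<close>, which the detour
    edges through \<open>q y\<close> cancel.\<close>
  have "(\<Sum>e\<in>E. w e * (\<phi> (snd e) - \<phi> (fst e))) =
      (\<Sum>y\<in>atoms c. measure c {y} * \<phi> ((r \<circ> t2) y)) -
      (\<Sum>x\<in>atoms a. measure a {x} * \<phi> ((p \<circ> s1) x))" for \<phi>
    using N1'(6)[of "\<phi> \<circ> p"] N2'(6)[of "\<phi> \<circ> r"]
    by (simp add: sum_E w, simp add: i_def j_def right_diff_distrib sum_subtractf)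
  moreover have "\<forall>e\<in>E. 0 < w e"
    using N1'(3) N2'(3) by (simp add: E_def ball_Un w measure_pos_atoms)
  moreover have "\<forall>e\<in>E. pos (fst e) \<noteq> pos (snd e)"
    using N1'(2,5) N2'(2,4) u by (auto simp: E_def i_def j_def pos)
  ultimately have "network a c E w pos (p \<circ> s1) (r \<circ> t2)"
    using N1'(1,4) N2'(1,5) fb by (simp add: network_def pos) (simp add: E_def)
  moreover have "acyclic E" if ac: "acyclic E1" "acyclic E2"
  proof -
    obtain \<rho>1 :: "'v \<Rightarrow> nat" where \<rho>1: "\<And>e. e \<in> E1 \<Longrightarrow> \<rho>1 (fst e) < \<rho>1 (snd e)"
      using acyclic_rank[OF N1'(1) ac(1)] by blast
    obtain \<rho>2 :: "'u \<Rightarrow> nat" where \<rho>2: "\<And>e. e \<in> E2 \<Longrightarrow> \<rho>2 (fst e) < \<rho>2 (snd e)"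
      using acyclic_rank[OF N2'(1) ac(2)] by blast
    \<comment> \<open>The detour points get a rank \<open>n\<close> above all \<open>t1 y\<close>,
      and the second network is shifted above \<open>n\<close>.\<close>
    obtain n where n: "\<And>y. y \<in> atoms b \<Longrightarrow> \<rho>1 (t1 y) < n"
      using finite_nat_set_iff_bounded[of "(\<rho>1 \<circ> t1) ` atoms b"] fb by auto
    show ?thesis
      using \<rho>1 \<rho>2 n
      by (intro acyclic_if_rank[where \<rho> = "case_sum \<rho>1 (case_sum (\<lambda>_. n) (\<lambda>v. Suc n + \<rho>2 v))"])
        (auto simp: E_def i_def j_def p_def q_def r_def)
  qed
  moreover have "edge_cost \<alpha> pos E w =
      edge_cost \<alpha> pos1 E1 w1 + edge_cost \<alpha> pos2 E2 w2 +
      2 * norm u * (\<Sum>y\<in>atoms b. measure b {y} powr \<alpha>)"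
  proof -
    have "dist (pos (fst (i y))) (pos (snd (i y))) = norm u"
      "dist (pos (fst (j y))) (pos (snd (j y))) = norm u" if "y \<in> atoms b" for y
      using N1'(5)[OF that] N2'(4)[OF that] by (simp_all add: i_def j_def pos dist_norm)
    then show ?thesis
      unfolding edge_cost_def
      by (simp add: sum_E w pos sum_distrib_right[symmetric])
  qed
  ultimately show ?thesis
    by blast
qed

section \<open>Lower bounds\<close>

text \<open>
  By acyclicity the set of descendants of the head of \<open>e\<close> has no outgoing edge and does not
  contain the tail of \<open>e\<close>, so the flow through \<open>e\<close> is absorbed in it.
\<close>

lemma acyclic_network_weight_le_1:
  assumes b: "b \<in> atomic_probability_measures"
    and N: "network a b E w pos s t" and ac: "acyclic E" and e: "e \<in> E"
  shows "w e \<le> 1"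
proof -
  note N' = networkD[OF N]
  define \<phi> where "\<phi> = (\<lambda>v. of_bool ((snd e, v) \<in> E\<^sup>*) :: real)"
  have \<phi>: "0 \<le> \<phi> v" "\<phi> v \<le> 1" for v
    by (auto simp: \<phi>_def)
  \<comment> \<open>No edge leaves the set of descendants, so all terms of the weak equation are
    nonnegative and the term of \<open>e\<close> is at most their sum.\<close>
  have mono: "\<phi> (fst e') \<le> \<phi> (snd e')" if "e' \<in> E" for e'
    using that rtrancl_into_rtrancl[of "snd e" "fst e'" E "snd e'"] by (auto simp: \<phi>_def)
  have "(fst e, snd e) \<in> E"
    using e by simp
  then have "(snd e, fst e) \<notin> E\<^sup>*"
    using ac rtrancl_into_trancl2 unfolding acyclic_def by metis
  then have "w e = w e * (\<phi> (snd e) - \<phi> (fst e))"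
    by (simp add: \<phi>_def)
  also have "\<dots> \<le> (\<Sum>e\<in>E. w e * (\<phi> (snd e) - \<phi> (fst e)))"
    using e N'(1,3) mono by (intro member_le_sum) (auto simp: less_imp_le)
  also have "\<dots> \<le> (\<Sum>y\<in>atoms b. measure b {y} * \<phi> (t y))"
    unfolding N'(6) using \<phi> by (simp add: sum_nonneg)
  also have "\<dots> \<le> (\<Sum>y\<in>atoms b. measure b {y} * 1)"
    using \<phi> by (intro sum_mono mult_left_mono) auto
  also have "\<dots> = 1"
    using b by (simp add: atomic_probability_measuresD)
  finally show ?thesis .
qed

text \<open>
  For every radius \<open>r < R\<close>, the edges leaving the ball of radius \<open>r\<close> around \<open>x\<close> carry at least
  the excess of \<open>a\<close> over \<open>b\<close> at \<open>x\<close>. The bound follows by integration over \<open>r\<close>.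
\<close>

lemma network_cost_ge:
  assumes a: "a \<in> atomic_probability_measures" and b: "b \<in> atomic_probability_measures"
    and N: "network a b E w pos s t" and ac: "\<alpha> < 0 \<longrightarrow> acyclic E" and \<alpha>: "\<alpha> \<le> 1"
    and R: "0 < R" "\<And>y. y \<in> atoms a \<union> atoms b \<Longrightarrow> y \<noteq> x \<Longrightarrow> R \<le> dist y x"
    and x: "measure b {x} < measure a {x}"
  shows "R * (measure a {x} - measure b {x}) \<le> edge_cost \<alpha> pos E w"
proof -
  note N' = networkD[OF N]
  define \<delta> where "\<delta> = measure a {x} - measure b {x}"
  have \<delta>: "0 < \<delta>" "\<delta> \<le> 1"
    using x measure_singleton_le_1[OF a, of x] measure_nonneg[of b "{x}"] unfolding \<delta>_def by linarith+
  \<comment> \<open>Radii of the spheres around \<open>x\<close> that \<open>e\<close> crosses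
    outward; empty for an edge directed inward. Half-open, since the test functions below are
    indicators of open balls.\<close>
  define I where "I = (\<lambda>e. {dist (pos (fst e)) x<..dist (pos (snd e)) x})"
  have le: "\<delta> * indicator {0<..<R} r \<le> (\<Sum>e\<in>E. w e powr \<alpha> * indicator (I e) r)" for r
  proof (cases "r \<in> {0<..<R}")
    case True
    define \<phi> where "\<phi> = (\<lambda>v. of_bool (dist (pos v) x < r) :: real)"
    \<comment> \<open>As \<open>r < R\<close>, no atom other than \<open>x\<close> can lie in the
      ball.\<close>
    have atom: "(\<Sum>y\<in>atoms c. measure c {y} * \<phi> (k y)) = measure c {x}"
      if "finite (atoms c)" "\<And>y. y \<in> atoms c \<Longrightarrow> pos (k y) = y"
        "\<And>y. y \<in> atoms c \<Longrightarrow> y \<noteq> x \<Longrightarrow> R \<le> dist y x" for c k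
    proof -
      have "(\<Sum>y\<in>atoms c. measure c {y} * \<phi> (k y)) =
          (\<Sum>y\<in>atoms c. if y = x then measure c {y} else 0)"
        using that(2,3) True by (intro sum.cong) (fastforce simp: \<phi>_def)+
      then show ?thesis
        using that(1) by (simp add: sum.delta measure_not_atoms)
    qed
    have "(\<Sum>y\<in>atoms a. measure a {y} * \<phi> (s y)) = measure a {x}"
      "(\<Sum>y\<in>atoms b. measure b {y} * \<phi> (t y)) = measure b {x}"
      using a b N'(4,5) R(2) by (auto intro!: atom simp: atomic_probability_measuresD)
    then have "\<delta> = - (\<Sum>e\<in>E. w e * (\<phi> (snd e) - \<phi> (fst e)))"
      unfolding N'(6) \<delta>_def by simp
    also have "\<dots> = (\<Sum>e\<in>E. w e * (\<phi> (fst e) - \<phi> (snd e)))"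
      by (simp add: sum_negf[symmetric] algebra_simps)
    also have "\<dots> \<le> (\<Sum>e\<in>E. w e * indicator (I e) r)"
      using N'(3) by (intro sum_mono mult_left_mono) (auto simp: \<phi>_def I_def less_imp_le)
    finally have cut: "\<delta> \<le> (\<Sum>e\<in>E. w e * indicator (I e) r)" .
    show ?thesis
    proof (cases "\<forall>e\<in>E. r \<in> I e \<longrightarrow> w e \<le> 1")
      case le1: True
      have "w e * indicator (I e) r \<le> w e powr \<alpha> * indicator (I e) r" if "e \<in> E" for e
        using powr_mono'[of \<alpha> 1 "w e"] N'(3)[OF that] le1 \<alpha> that by (auto simp: indicator_def)
      then have "(\<Sum>e\<in>E. w e * indicator (I e) r) \<le> (\<Sum>e\<in>E. w e powr \<alpha> * indicator (I e) r)"
        by (rule sum_mono)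
      with cut True show ?thesis
        by simp
    next
      case False
      \<comment> \<open>A heavy edge excludes \<open>\<alpha> < 0\<close>; for
        \<open>\<alpha> \<ge> 0\<close> it alone contributes at least 1, and
        \<open>\<delta> \<le> 1\<close>.\<close>
      then obtain e where e: "e \<in> E" "r \<in> I e" "1 < w e"
        by (auto simp: not_le)
      then have "0 \<le> \<alpha>"
        using acyclic_network_weight_le_1[OF b N _ e(1)] ac by force
      then have "1 \<le> w e powr \<alpha> * indicator (I e) r"
        using e by (simp add: ge_one_powr_ge_zero)
      also have "\<dots> \<le> (\<Sum>e\<in>E. w e powr \<alpha> * indicator (I e) r)"
        using e N'(1) by (intro member_le_sum) auto
      finally show ?thesis
        using \<delta> True by simp
    qed
  qed (simp add: sum_nonneg)
  have fin: "emeasure lborel (I e) < \<infinity>" for e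
    unfolding I_def by (intro emeasure_bounded_finite) simp
  have int: "integrable lborel (indicator {0<..<R} :: real \<Rightarrow> real)"
    by (intro integrable_real_indicator emeasure_bounded_finite) auto
  have "R * \<delta> = (LINT r|lborel. \<delta> * indicator {0<..<R} r)"
    using R(1) by simp
  also have "\<dots> \<le> (LINT r|lborel. (\<Sum>e\<in>E. w e powr \<alpha> * indicator (I e) r))"
    using fin int by (intro integral_mono le) (auto simp: I_def)
  also have "\<dots> = (\<Sum>e\<in>E. w e powr \<alpha> * measure lborel (I e))"
    using fin by (subst Bochner_Integration.integral_sum) (auto simp: I_def)
  also have "\<dots> \<le> edge_cost \<alpha> pos E w"
    unfolding edge_cost_def
  proof (intro sum_mono mult_left_mono)
    fix e
    \<comment> \<open>The measure of \<open>I e\<close> is the increase of the distance to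
      \<open>x\<close> along \<open>e\<close>, or 0 if there is none.\<close>
    show "measure lborel (I e) \<le> dist (pos (fst e)) (pos (snd e))"
      using dist_triangle3[of "pos (snd e)" x "pos (fst e)"]
      by (cases "dist (pos (fst e)) x \<le> dist (pos (snd e)) x")
        (auto simp: I_def dist_commute)
  qed simp
  finally show ?thesis
    by (simp add: \<delta>_def)
qed

section \<open>The distance\<close>

lemma path_costs_nonneg: "c \<in> path_costs \<alpha> a b \<Longrightarrow> 0 \<le> c"
  by (auto simp: path_costs_def M_cost_eq_edge_cost edge_cost_nonneg split: if_splits)

lemma path_costs_nonempty:
  assumes "a \<in> atomic_probability_measures" "b \<in> atomic_probability_measures" "\<alpha> \<le> 1"
  shows "path_costs \<alpha> a b \<noteq> {}"
  using network_through_hub[OF assms(1,2)] network_path_costs[OF assms(1,2) _ _ assms(3)] by blast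

lemma d_alpha_le:
  assumes ab: "a \<in> atomic_probability_measures" "b \<in> atomic_probability_measures" and "\<alpha> \<le> 1"
    and "network a b E w pos s t" "\<alpha> < 0 \<longrightarrow> acyclic E"
  shows "d_alpha \<alpha> a b \<le> edge_cost \<alpha> pos E w"
proof -
  obtain c where c: "c \<in> path_costs \<alpha> a b" "c \<le> edge_cost \<alpha> pos E w"
    using network_path_costs[OF ab assms(4,5,3)] by blast
  have "Inf (path_costs \<alpha> a b) \<le> c"
    using c(1) bdd_belowI[OF path_costs_nonneg] by (rule cInf_lower)
  with c(2) ab show ?thesis
    by (simp add: d_alpha_def)
qed

lemma d_alpha_geI:
  assumes ab: "a \<in> atomic_probability_measures" "b \<in> atomic_probability_measures" and "\<alpha> \<le> 1"
    and "\<And>(E :: (nat \<times> nat) set) w pos s t. network a b E w pos s t \<Longrightarrow> \<alpha> < 0 \<longrightarrow> acyclic E \<Longrightarrow>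
      C \<le> edge_cost \<alpha> pos E w"
  shows "C \<le> d_alpha \<alpha> a b"
proof -
  have "C \<le> c" if "c \<in> path_costs \<alpha> a b" for c
    using path_costs_network[OF ab that assms(3)] assms(4) by (meson order_trans)
  then show ?thesis
    using ab path_costs_nonempty[OF ab assms(3)] by (auto simp: d_alpha_def intro!: cInf_greatest)
qed

lemma d_alpha_nonneg:
  assumes "\<alpha> \<le> 1"
  shows "0 \<le> d_alpha \<alpha> a b"
  using d_alpha_geI[of a b \<alpha> 0] assms edge_cost_nonneg by (auto simp: d_alpha_def)

lemma d_alpha_commute_le:
  assumes ab: "a \<in> atomic_probability_measures" "b \<in> atomic_probability_measures" and "\<alpha> \<le> 1"
  shows "d_alpha \<alpha> b a \<le> d_alpha \<alpha> a b"
proof (rule d_alpha_geI[OF ab \<open>\<alpha> \<le> 1\<close>])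
  fix E :: "(nat \<times> nat) set" and w pos s t
  assume N: "network a b E w pos s t" and "\<alpha> < 0 \<longrightarrow> acyclic E"
  then have "d_alpha \<alpha> b a \<le> edge_cost \<alpha> pos (E\<inverse>) (w \<circ> prod.swap)"
    using ab \<open>\<alpha> \<le> 1\<close> network_reverse(1)[OF N] by (intro d_alpha_le) auto
  then show "d_alpha \<alpha> b a \<le> edge_cost \<alpha> pos E w"
    by (simp add: network_reverse(2)[OF N])
qed

text \<open>The bound of \<open>network_cost_ge\<close> depends on the measures but not on the
  network, so it survives the infimum.\<close>

lemma d_alpha_pos:
  assumes ab: "a \<in> atomic_probability_measures" "b \<in> atomic_probability_measures"
    and "\<alpha> \<le> 1" "a \<noteq> b"
  shows "0 < d_alpha \<alpha> a b"
proof -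
  obtain x where x: "measure b {x} < measure a {x}"
    using ex_less_measure_singleton[OF ab \<open>a \<noteq> b\<close>] ..
  have "finite (atoms a \<union> atoms b)"
    using ab by (simp add: atomic_probability_measuresD)
  from finite_set_avoid[OF this, of x] obtain R
    where R: "0 < R" "\<And>y. y \<in> atoms a \<union> atoms b \<Longrightarrow> y \<noteq> x \<Longrightarrow> R \<le> dist y x"
    by (auto simp: dist_commute)
  have "R * (measure a {x} - measure b {x}) \<le> d_alpha \<alpha> a b"
    by (rule d_alpha_geI[OF ab \<open>\<alpha> \<le> 1\<close>], rule network_cost_ge[OF ab _ _ \<open>\<alpha> \<le> 1\<close> R x])
  moreover have "0 < R * (measure a {x} - measure b {x})"
    using R(1) x by simp
  ultimately show ?thesis
    by linarith
qed

text \<open>Concatenation costs the sum of both costs plus a detour that shrinks with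
  \<open>u\<close>. The infimum is then taken over the first network with the second fixed, and
  afterwards over the second.\<close>

lemma d_alpha_triangle:
  fixes a b c :: "(real^'m) measure"
  assumes a: "a \<in> atomic_probability_measures" and b: "b \<in> atomic_probability_measures"
    and c: "c \<in> atomic_probability_measures" and \<alpha>: "\<alpha> \<le> 1"
  shows "d_alpha \<alpha> a c \<le> d_alpha \<alpha> a b + d_alpha \<alpha> b c"
proof -
  have concat: "d_alpha \<alpha> a c \<le> edge_cost \<alpha> pos1 E1 w1 + edge_cost \<alpha> pos2 E2 w2"
    if N1: "network a b E1 w1 pos1 s1 t1" "\<alpha> < 0 \<longrightarrow> acyclic E1"
      and N2: "network b c E2 w2 pos2 s2 t2" "\<alpha> < 0 \<longrightarrow> acyclic E2"
    for E1 E2 :: "(nat \<times> nat) set" and w1 w2 pos1 pos2 s1 s2 t1 t2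
  proof (rule field_le_epsilon)
    fix \<epsilon> :: real assume "0 < \<epsilon>"
    define K where "K = (\<Sum>y\<in>atoms b. measure b {y} powr \<alpha>)"
    have K: "0 \<le> K"
      by (simp add: K_def sum_nonneg)
    \<comment> \<open>With this norm the detour costs
      \<open>\<epsilon> * K / (K + 1) \<le> \<epsilon>\<close>; the summand 1 makes the denominator
      positive from \<open>0 \<le> K\<close>.\<close>
    obtain u :: "real^'m" where u: "norm u = \<epsilon> / (2 * (K + 1))"
      using vector_choose_size[of "\<epsilon> / (2 * (K + 1))"] \<open>0 < \<epsilon>\<close> K by auto
    then have "u \<noteq> 0"
      using \<open>0 < \<epsilon>\<close> K by auto
    from network_concat[OF b N1(1) N2(1) this, of \<alpha>]
    obtain E :: "(nat + real^'m + nat) rel" and w pos s t where N: "network a c E w pos s t"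
      "acyclic E1 \<and> acyclic E2 \<longrightarrow> acyclic E"
      and cost: "edge_cost \<alpha> pos E w =
        edge_cost \<alpha> pos1 E1 w1 + edge_cost \<alpha> pos2 E2 w2 + 2 * norm u * K"
      unfolding K_def by blast
    have "d_alpha \<alpha> a c \<le> edge_cost \<alpha> pos E w"
      using N N1(2) N2(2) by (intro d_alpha_le[OF a c \<alpha>]) auto
    moreover have "2 * norm u * K \<le> \<epsilon>"
      using K \<open>0 < \<epsilon>\<close> by (simp add: u field_simps)
    ultimately show "d_alpha \<alpha> a c \<le> edge_cost \<alpha> pos1 E1 w1 + edge_cost \<alpha> pos2 E2 w2 + \<epsilon>"
      using cost by linarith
  qed
  have "d_alpha \<alpha> a c - d_alpha \<alpha> a b \<le> d_alpha \<alpha> b c"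
  proof (rule d_alpha_geI[OF b c \<alpha>])
    fix E2 :: "(nat \<times> nat) set" and w2 pos2 s2 t2
    assume N2: "network b c E2 w2 pos2 s2 t2" "\<alpha> < 0 \<longrightarrow> acyclic E2"
    have "d_alpha \<alpha> a c - edge_cost \<alpha> pos2 E2 w2 \<le> d_alpha \<alpha> a b"
      using concat[OF _ _ N2] by (intro d_alpha_geI[OF a b \<alpha>]) force
    then show "d_alpha \<alpha> a c - d_alpha \<alpha> a b \<le> edge_cost \<alpha> pos2 E2 w2"
      by linarith
  qed
  then show ?thesis
    by linarith
qed

theorem proposition2p3p4:
  fixes \<alpha> :: real
  assumes "\<alpha> \<le> 1"
  shows "Metric_space (atomic_probability_measures :: (real^'m) measure set) (d_alpha \<alpha>)"
proof
  fix a b c :: "(real^'m) measure"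
  show "0 \<le> d_alpha \<alpha> a b"
    using assms by (rule d_alpha_nonneg)
  \<comment> \<open>If \<open>a\<close> or \<open>b\<close> is not an atomic probability measure,
    both sides are 0 by definition.\<close>
  show "d_alpha \<alpha> a b = d_alpha \<alpha> b a"
    using d_alpha_commute_le[of a b \<alpha>] d_alpha_commute_le[of b a \<alpha>] assms
    by (fastforce simp: d_alpha_def[of \<alpha> a b] d_alpha_def[of \<alpha> b a] intro: antisym)
  assume a: "a \<in> atomic_probability_measures" and b: "b \<in> atomic_probability_measures"
  have "d_alpha \<alpha> a a \<le> edge_cost \<alpha> (\<lambda>x :: real^'m. x) {} (\<lambda>_. 1)"
    by (rule d_alpha_le[OF a a assms network_self]) (simp add: acyclic_def)
  then have "d_alpha \<alpha> a a = 0"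
    using d_alpha_nonneg[OF assms, of a a] by (simp add: edge_cost_def)
  then show "d_alpha \<alpha> a b = 0 \<longleftrightarrow> a = b"
    using d_alpha_pos[OF a b assms] by force
  assume "c \<in> atomic_probability_measures"
  with a b assms show "d_alpha \<alpha> a c \<le> d_alpha \<alpha> a b + d_alpha \<alpha> b c"
    by (intro d_alpha_triangle)
qed

end
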